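(* Let $E\subset\mathbb{R}^2$ be an ellipse and let $L\subset\mathbb{R}^2$ be a line that intersects $E$ and is not tangent to $E$. Then the Douglas-Rachford algorithm for $E$ and $L$ is locally convergent at each feasible point: for every $f\in E\cap L$ there is a neighbourhood $N$ of $f$ in $\mathbb{R}^2$ such that, for every $x_0\in N$, every sequence $(x_n)_{n\ge 0}$ starting at $x_0$ with $x_{n+1}\in T_{E,L}(x_n)$ for all $n\ge 0$ satisfies $\|x_n-f\|\to 0$ as $n\to\infty$.
   Context: $\mathbb{R}^2$ carries the Euclidean norm $\|\cdot\|$. An ellipse means the curve itself (not the region it bounds); up to a rigid motion and scaling it is $E_b=\{(x,y)\in\mathbb{R}^2 : x^2+(y/b)^2=1\}$ for some $b>0$. For a nonempty closed set $C$, the (possibly set-valued) projection is $P_C(x)=\{z\in C:\|x-z\|=\inf_{z'\in C}\|x-z'\|\}$ and the reflection is $R_C=2P_C-I$, i.e. $R_C(x)=\{2z-x: z\in P_C(x)\}$, where $I$ is the identity. For closed sets $A,B$ the Douglas-Rachford operator is $T_{A,B}=\frac12(I+R_BR_A)$, so that $T_{A,B}(x)=\{\frac12(x+w): w\in R_B(r),\ r\in R_A(x)\}$. A feasible point is a point of $A\cap B$. *)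

theory Defs
  imports "HOL-Analysis.Analysis"
begin

definition proj_set :: "'a::metric_space set \<Rightarrow> 'a \<Rightarrow> 'a set" where
  "proj_set C x = {z \<in> C. dist x z = infdist x C}"

definition reflection :: "'a::real_normed_vector set \<Rightarrow> 'a \<Rightarrow> 'a set" where
  "reflection C x = {2 *\<^sub>R z - x | z. z \<in> proj_set C x}"

(* The reflection in A is applied first, then the one in B. *)
definition douglas_rachford ::
    "'a::real_normed_vector set \<Rightarrow> 'a set \<Rightarrow> 'a \<Rightarrow> 'a set" where
  "douglas_rachford A B x =
     {(1/2) *\<^sub>R (x + w) | r w. r \<in> reflection A x \<and> w \<in> reflection B r}"

definition standard_ellipse :: "real \<Rightarrow> (real^2) set" where
  "standard_ellipse b = {p. (p $ 1)\<^sup>2 + (p $ 2 / b)\<^sup>2 = 1}"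

(* Scaling by c, the orthogonal map Q and translation by a; circles are included (b = 1). *)
definition ellipse :: "(real^2) set \<Rightarrow> bool" where
  "ellipse E \<longleftrightarrow> (\<exists>b c Q a. b > 0 \<and> c > 0 \<and> orthogonal_transformation Q \<and>
     E = (\<lambda>p. a + c *\<^sub>R Q p) ` standard_ellipse b)"

definition line :: "'a::euclidean_space set \<Rightarrow> bool" where
  "line L \<longleftrightarrow> affine L \<and> aff_dim L = 1"

(* Tangent vectors of C at g 0 are the velocities at 0 of curves g that stay in C near time 0;
   a tangent line is spanned by a nonzero one. *)
definition tangent_line :: "'a::euclidean_space set \<Rightarrow> 'a set \<Rightarrow> bool" where
  "tangent_line C L \<longleftrightarrow> (\<exists>g v. (\<forall>\<^sub>F t in nhds (0::real). g t \<in> C) \<and>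
     (g has_vector_derivative v) (at 0) \<and> v \<noteq> 0 \<and>
     L = range (\<lambda>s. g 0 + s *\<^sub>R v))"

end

theory Submission
  imports Defs
begin

text \<open>
  Let \<open>u\<close> be the unit tangent of \<open>E\<close> at \<open>f\<close> and \<open>v\<close> a unit direction of \<open>L\<close>. A nearest point
  \<open>z\<close> of \<open>E\<close> to \<open>x\<close> satisfies \<open>\<parallel>z - f\<parallel> \<le> 2 \<parallel>x - f\<parallel>\<close>, and \<open>x - z\<close> is orthogonal to the tangent of
  \<open>E\<close> at \<open>z\<close>, which differs from the one at \<open>f\<close> by \<open>O(\<parallel>z - f\<parallel>)\<close>. Hence \<open>z - f\<close> agrees with the
  projection of \<open>x - f\<close> to the span of \<open>u\<close> up to \<open>O(\<parallel>x - f\<parallel>\<^sup>2)\<close>; uniqueness or smoothness of the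
  projection is not needed. To first order the Douglas-Rachford operator at \<open>f\<close> is therefore half
  of the identity plus the composition of the reflections in the spans of \<open>u\<close> and \<open>v\<close>, which in the plane
  scales norms by \<open>\<bar>u \<bullet> v\<bar>\<close>. This is less than 1 because \<open>L\<close> is not tangent.
\<close>

section \<open>Nearest points and their first-order condition\<close>

lemma proj_setD:
  assumes "z \<in> proj_set C x"
  shows "z \<in> C" and "y \<in> C \<Longrightarrow> dist x z \<le> dist x y"
  using assms by (auto simp: proj_set_def infdist_le)

lemma dist_proj_set_le:
  assumes "z \<in> proj_set C x" "f \<in> C"
  shows "dist z f \<le> 2 * dist x f"
  using proj_setD(2)[OF assms] dist_triangle[of z f x] by (simp add: dist_commute[of z x])

text \<open>Fermat's rule: the squared distance from \<open>x\<close> along \<open>g\<close> is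
  minimal at \<open>t\<close>, so its derivative there vanishes.\<close>

lemma proj_set_orthogonal_velocity:
  fixes g :: "real \<Rightarrow> 'a::real_inner"
  assumes "g t \<in> proj_set C x" "\<And>s. g s \<in> C" "(g has_vector_derivative v) (at t)"
  shows "(x - g t) \<bullet> v = 0"
proof -
  let ?\<phi> = "\<lambda>s. (x - g s) \<bullet> (x - g s)"
  have "(?\<phi> has_real_derivative - 2 * ((x - g t) \<bullet> v)) (at t)"
    using assms(3) unfolding has_vector_derivative_def has_field_derivative_def
    by (auto intro!: derivative_eq_intros simp: inner_commute[of v])
  moreover have "?\<phi> t \<le> ?\<phi> s" for s
    using proj_setD(2)[OF assms(1) assms(2)[of s]] by (simp add: dist_norm norm_le)
  ultimately have "- 2 * ((x - g t) \<bullet> v) = 0"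
    by (intro DERIV_local_min[where d = 1]) auto
  then show ?thesis by simp
qed

section \<open>Chords and velocities of trigonometric curves\<close>

text \<open>For orthogonal nonzero \<open>p\<close> and \<open>q\<close> the range is the ellipse
  with centre \<open>a\<close> and semi-axes \<open>p\<close> and \<open>q\<close>.\<close>

definition trig_curve :: "'a::real_vector \<Rightarrow> 'a \<Rightarrow> 'a \<Rightarrow> real \<Rightarrow> 'a" where
  "trig_curve a p q t = a + cos t *\<^sub>R p + sin t *\<^sub>R q"

definition trig_velocity :: "'a::real_vector \<Rightarrow> 'a \<Rightarrow> real \<Rightarrow> 'a" where
  "trig_velocity p q t = - sin t *\<^sub>R p + cos t *\<^sub>R q"

lemma trig_curve_has_vector_derivative:
  "(trig_curve a p q has_vector_derivative trig_velocity p q t) (at t)"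
  unfolding trig_curve_def trig_velocity_def by (auto intro!: derivative_eq_intros)

lemma norm_orthogonal_combination:
  fixes p q :: "'a::real_inner"
  assumes "p \<bullet> q = 0"
  shows "(norm (\<alpha> *\<^sub>R p + \<beta> *\<^sub>R q))\<^sup>2 = \<alpha>\<^sup>2 * (norm p)\<^sup>2 + \<beta>\<^sup>2 * (norm q)\<^sup>2"
  using assms unfolding power2_norm_eq_inner
  by (simp add: inner_add_left inner_add_right inner_commute[of q p] power2_eq_square)

text \<open>The linear map taking coordinates to combinations of \<open>p\<close> and
  \<open>q\<close> has singular values \<open>norm p\<close> and \<open>norm q\<close>. This carries
  estimates from the unit circle over to the ellipse.\<close>

lemma norm_orthogonal_combination_bounds:
  fixes p q :: "'a::real_inner"
  assumes "p \<bullet> q = 0"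
  shows "min (norm p) (norm q) * sqrt (\<alpha>\<^sup>2 + \<beta>\<^sup>2) \<le> norm (\<alpha> *\<^sub>R p + \<beta> *\<^sub>R q)" (is "?l \<le> ?n")
    and "norm (\<alpha> *\<^sub>R p + \<beta> *\<^sub>R q) \<le> max (norm p) (norm q) * sqrt (\<alpha>\<^sup>2 + \<beta>\<^sup>2)" (is "_ \<le> ?r")
proof -
  have "?l\<^sup>2 \<le> ?n\<^sup>2"
    unfolding norm_orthogonal_combination[OF assms] power_mult_distrib
    by (auto simp: distrib_left mult.commute intro!: add_mono mult_left_mono power_mono)
  then show "?l \<le> ?n" by (rule power2_le_imp_le) simp
  have "?n\<^sup>2 \<le> ?r\<^sup>2"
    unfolding norm_orthogonal_combination[OF assms] power_mult_distrib
    by (auto simp: distrib_left mult.commute intro!: add_mono mult_left_mono power_mono)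
  then show "?n \<le> ?r" by (rule power2_le_imp_le) (simp add: le_max_iff_disj)
qed

lemma trig_velocity_nonzero:
  fixes p q :: "'a::real_inner"
  assumes "p \<bullet> q = 0" "p \<noteq> 0" "q \<noteq> 0"
  shows "trig_velocity p q t \<noteq> 0"
proof -
  have "0 < min (norm p) (norm q) * sqrt ((- sin t)\<^sup>2 + (cos t)\<^sup>2)"
    using assms by simp
  also have "\<dots> \<le> norm (trig_velocity p q t)"
    unfolding trig_velocity_def by (rule norm_orthogonal_combination_bounds(1)[OF assms(1)])
  finally show ?thesis by auto
qed

text \<open>In coordinates with respect to \<open>p\<close> and \<open>q\<close> the curve is the
  unit circle and velocity is position after a quarter turn, so velocity differences and chords have
  the same coordinate length. Bounds by the chord instead of \<open>s - t\<close> are insensitive to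
  periodicity.\<close>

lemma trig_curve_second_order:
  fixes p q :: "'a::real_inner"
  assumes "p \<bullet> q = 0" "p \<noteq> 0" "q \<noteq> 0"
  obtains C where "C \<ge> 0"
    and "\<And>s t. norm (trig_velocity p q s - trig_velocity p q t)
           \<le> C * norm (trig_curve a p q s - trig_curve a p q t)"
    and "\<And>s t. \<exists>k. norm (trig_curve a p q s - trig_curve a p q t - k *\<^sub>R trig_velocity p q t)
           \<le> C * (norm (trig_curve a p q s - trig_curve a p q t))\<^sup>2"
proof -
  define m M where "m = min (norm p) (norm q)" and "M = max (norm p) (norm q)"
  have m: "m > 0" and M: "M > 0" using assms by (auto simp: m_def M_def less_max_iff_disj)
  define D where "D s t = sqrt ((cos s - cos t)\<^sup>2 + (sin s - sin t)\<^sup>2)" for s t :: real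
  \<comment> \<open>The first entry serves the velocities. The second serves the deviation from the
    tangent, which is \<open>D\<^sup>2 / 2\<close> on the circle; passing from \<open>D\<close> to
    the chord costs \<open>m\<^sup>2\<close>.\<close>
  define C where "C = max (M / m) (M / (2 * m\<^sup>2))"
  have curve: "trig_curve a p q s - trig_curve a p q t
      = (cos s - cos t) *\<^sub>R p + (sin s - sin t) *\<^sub>R q" for s t
    by (simp add: trig_curve_def algebra_simps)
  have lower: "m * D s t \<le> norm (trig_curve a p q s - trig_curve a p q t)" for s t
    unfolding curve D_def m_def by (rule norm_orthogonal_combination_bounds(1)[OF assms(1)])
  have D0: "D s t \<ge> 0" for s t by (simp add: D_def)
  show thesis
  proof (rule that)
    show "C \<ge> 0" using m M by (simp add: C_def le_max_iff_disj)
    show "norm (trig_velocity p q s - trig_velocity p q t)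
        \<le> C * norm (trig_curve a p q s - trig_curve a p q t)" for s t
    proof -
      have "trig_velocity p q s - trig_velocity p q t
          = (sin t - sin s) *\<^sub>R p + (cos s - cos t) *\<^sub>R q"
        by (simp add: trig_velocity_def algebra_simps)
      then have "norm (trig_velocity p q s - trig_velocity p q t)
          \<le> M * sqrt ((sin t - sin s)\<^sup>2 + (cos s - cos t)\<^sup>2)"
        using norm_orthogonal_combination_bounds(2)[OF assms(1)] by (simp add: M_def)
      also have "\<dots> = M / m * (m * D s t)"
        using m by (simp add: D_def power2_commute[of "sin t"] add.commute)
      also have "\<dots> \<le> C * norm (trig_curve a p q s - trig_curve a p q t)"
        using lower m M D0 by (intro mult_mono) (auto simp: C_def le_max_iff_disj)
      finally show ?thesis .
    qed
    show "\<exists>k. norm (trig_curve a p q s - trig_curve a p q t - k *\<^sub>R trig_velocity p q t)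
        \<le> C * (norm (trig_curve a p q s - trig_curve a p q t))\<^sup>2" for s t
    proof -
      \<comment> \<open>On the unit circle the chord has component \<open>- D\<^sup>2/2\<close> along the radius at \<open>t\<close>.\<close>
      define k where "k = sin (s - t)"
      have circ: "(cos s)\<^sup>2 + (sin s)\<^sup>2 = 1" "(cos t)\<^sup>2 + (sin t)\<^sup>2 = 1" by simp_all
      have D2: "(D s t)\<^sup>2 = (cos s - cos t)\<^sup>2 + (sin s - sin t)\<^sup>2" by (simp add: D_def)
      have half: "(D s t)\<^sup>2 / 2 = 1 - cos s * cos t - sin s * sin t"
        unfolding D2 power2_diff using circ by (simp add: field_simps)
      \<comment> \<open>Multiplying by \<open>(cos t)\<^sup>2 + (sin t)\<^sup>2 = 1\<close> makes
        the two sides of \<open>c1\<close> and \<open>c2\<close> match term by term.\<close>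
      have split: "y = y * (cos t * cos t) + y * (sin t * sin t)" for y :: real
        using circ(2) by (simp add: power2_eq_square flip: distrib_left)
      have c1: "cos s - cos t + k * sin t = - ((D s t)\<^sup>2 / 2) * cos t"
        unfolding half k_def sin_diff using split[of "cos s"] by (simp add: algebra_simps)
      have c2: "sin s - sin t - k * cos t = - ((D s t)\<^sup>2 / 2) * sin t"
        unfolding half k_def sin_diff using split[of "sin s"] by (simp add: algebra_simps)
      have "trig_curve a p q s - trig_curve a p q t - k *\<^sub>R trig_velocity p q t
          = (cos s - cos t + k * sin t) *\<^sub>R p + (sin s - sin t - k * cos t) *\<^sub>R q"
        by (simp add: trig_curve_def trig_velocity_def algebra_simps)
      also have "\<dots> = (- ((D s t)\<^sup>2 / 2)) *\<^sub>R (cos t *\<^sub>R p + sin t *\<^sub>R q)"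
        unfolding c1 c2 by (simp add: scaleR_add_right)
      finally have "norm (trig_curve a p q s - trig_curve a p q t - k *\<^sub>R trig_velocity p q t)
          = (D s t)\<^sup>2 / 2 * norm (cos t *\<^sub>R p + sin t *\<^sub>R q)"
        by simp
      also have "\<dots> \<le> (D s t)\<^sup>2 / 2 * M"
        using norm_orthogonal_combination_bounds(2)[OF assms(1), of "cos t" "sin t"]
        by (intro mult_left_mono) (auto simp: M_def)
      also have "\<dots> = M / (2 * m\<^sup>2) * (m * D s t)\<^sup>2"
        using m by (simp add: power_mult_distrib)
      also have "\<dots> \<le> C * (norm (trig_curve a p q s - trig_curve a p q t))\<^sup>2"
        using lower[of s t] m M D0[of s t]
        by (intro mult_mono power_mono) (auto simp: C_def le_max_iff_disj)
      finally show ?thesis by blast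
    qed
  qed
qed

section \<open>Nearest points on the curve and on a line, to second order\<close>

lemma norm_diff_projection_le:
  fixes u w :: "'a::real_inner"
  assumes "norm u = 1"
  shows "norm (w - (w \<bullet> u) *\<^sub>R u) \<le> norm w"
proof -
  have "u \<bullet> u = 1" using assms by (simp add: norm_eq_1)
  then have "(norm (w - (w \<bullet> u) *\<^sub>R u))\<^sup>2 = (norm w)\<^sup>2 - (w \<bullet> u)\<^sup>2"
    unfolding power2_norm_eq_inner
    by (simp add: inner_diff_left inner_diff_right inner_commute[of u w] power2_eq_square)
  then have "(norm (w - (w \<bullet> u) *\<^sub>R u))\<^sup>2 \<le> (norm w)\<^sup>2" by simp
  then show ?thesis by (rule power2_le_imp_le) simp
qed

text \<open>The error is split into parts normal and parallel to \<open>u\<close>: the chord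
  estimate bounds the first, orthogonality at \<open>z\<close> the second. Both inputs are global,
  so the bound holds for every \<open>x\<close>.\<close>

lemma proj_set_trig_curve_second_order:
  fixes a p q :: "'a::real_inner" and t :: real
  assumes "p \<bullet> q = 0" "p \<noteq> 0" "q \<noteq> 0"
  defines "f \<equiv> trig_curve a p q t" and "u \<equiv> sgn (trig_velocity p q t)"
  obtains K where "K \<ge> 0"
    and "\<And>x z. z \<in> proj_set (range (trig_curve a p q)) x \<Longrightarrow>
           norm (z - f - ((x - f) \<bullet> u) *\<^sub>R u) \<le> K * (norm (x - f))\<^sup>2"
proof -
  obtain C where C: "C \<ge> 0"
    and vel: "\<And>s t. norm (trig_velocity p q s - trig_velocity p q t)
           \<le> C * norm (trig_curve a p q s - trig_curve a p q t)"
    and chord: "\<And>s t. \<exists>k. norm (trig_curve a p q s - trig_curve a p q t - k *\<^sub>R trig_velocity p q t)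
           \<le> C * (norm (trig_curve a p q s - trig_curve a p q t))\<^sup>2"
    using trig_curve_second_order[OF assms(1-3), of a] by blast
  define \<tau> where "\<tau> = trig_velocity p q t"
  have \<tau>0: "norm \<tau> > 0" using trig_velocity_nonzero[OF assms(1-3)] by (simp add: \<tau>_def)
  have u1: "norm u = 1" using \<tau>0 by (simp add: u_def \<tau>_def norm_sgn)
  have \<tau>: "\<tau> = norm \<tau> *\<^sub>R u" using \<tau>0 by (simp add: u_def \<tau>_def sgn_div_norm)
  \<comment> \<open>\<open>4 * C\<close> pays for the normal part and
    \<open>2 * C / norm \<tau>\<close> for the tangential one; the factors 4 and 2 come from
    \<open>norm (z - f) \<le> 2 * norm (x - f)\<close>.\<close>
  have bound: "norm (z - f - ((x - f) \<bullet> u) *\<^sub>R u) \<le> (4 * C + 2 * C / norm \<tau>) * (norm (x - f))\<^sup>2"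
    if z: "z \<in> proj_set (range (trig_curve a p q)) x" for x z
  proof -
    obtain s where s: "z = trig_curve a p q s" using proj_setD(1)[OF z] by auto
    have zf: "norm (z - f) \<le> 2 * norm (x - f)"
      using dist_proj_set_le[OF z, of f] by (simp add: f_def dist_norm)
    have xz: "norm (x - z) \<le> norm (x - f)"
      using proj_setD(2)[OF z, of f] by (simp add: f_def dist_norm)
    have orth: "(x - z) \<bullet> trig_velocity p q s = 0"
      unfolding s
      by (rule proj_set_orthogonal_velocity[OF z[unfolded s] _ trig_curve_has_vector_derivative])
        simp
    obtain k where k: "norm (z - f - k *\<^sub>R \<tau>) \<le> C * (norm (z - f))\<^sup>2"
      using chord[of s t] by (auto simp: s f_def \<tau>_def)
    define e where "e = z - f - k *\<^sub>R \<tau>"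
    \<comment> \<open>The multiple of \<open>\<tau>\<close> in \<open>z - f\<close> lies along
      \<open>u\<close> and drops out.\<close>
    have "(z - f) - ((z - f) \<bullet> u) *\<^sub>R u = e - (e \<bullet> u) *\<^sub>R u"
    proof -
      have "u \<bullet> u = 1" using u1 by (simp add: norm_eq_1)
      moreover have "z - f = e + (k * norm \<tau>) *\<^sub>R u" by (simp add: e_def \<tau>[symmetric] flip: scaleR_scaleR)
      ultimately show ?thesis by (simp add: inner_add_left algebra_simps)
    qed
    then have "norm ((z - f) - ((z - f) \<bullet> u) *\<^sub>R u) \<le> norm e"
      using norm_diff_projection_le[OF u1, of e] by simp
    also have "\<dots> \<le> C * (norm (z - f))\<^sup>2" using k by (simp add: e_def)
    also have "\<dots> \<le> C * (2 * norm (x - f))\<^sup>2"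
      using zf C by (intro mult_left_mono power_mono) auto
    finally have normal: "norm ((z - f) - ((z - f) \<bullet> u) *\<^sub>R u) \<le> 4 * C * (norm (x - f))\<^sup>2"
      by (simp add: power_mult_distrib)
    \<comment> \<open>Subtracting the velocity at \<open>z\<close>, to which \<open>x - z\<close> is
      orthogonal, replaces \<open>\<tau>\<close> by a velocity difference and so gains a second
      small factor.\<close>
    have "norm \<tau> * \<bar>(x - z) \<bullet> u\<bar> = \<bar>(x - z) \<bullet> \<tau>\<bar>"
      by (subst (2) \<tau>) (simp add: abs_mult)
    also have "\<dots> = \<bar>(x - z) \<bullet> (trig_velocity p q s - \<tau>)\<bar>"
      using orth by (simp add: inner_diff_right)
    also have "\<dots> \<le> norm (x - z) * norm (trig_velocity p q s - \<tau>)"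
      by (rule Cauchy_Schwarz_ineq2)
    also have "\<dots> \<le> norm (x - f) * (C * norm (z - f))"
      using xz vel[of s t] by (intro mult_mono) (auto simp: s f_def \<tau>_def)
    also have "\<dots> \<le> norm (x - f) * (C * (2 * norm (x - f)))"
      using zf C by (intro mult_left_mono) auto
    finally have "\<bar>(x - z) \<bullet> u\<bar> \<le> 2 * C / norm \<tau> * (norm (x - f))\<^sup>2"
      using \<tau>0 by (simp add: field_simps power2_eq_square)
    moreover have "norm (((x - z) \<bullet> u) *\<^sub>R u) = \<bar>(x - z) \<bullet> u\<bar>" using u1 by simp
    moreover have "z - f - ((x - f) \<bullet> u) *\<^sub>R u
        = ((z - f) - ((z - f) \<bullet> u) *\<^sub>R u) - ((x - z) \<bullet> u) *\<^sub>R u"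
      by (simp add: inner_diff_left algebra_simps)
    then have "norm (z - f - ((x - f) \<bullet> u) *\<^sub>R u)
        \<le> norm ((z - f) - ((z - f) \<bullet> u) *\<^sub>R u) + norm (((x - z) \<bullet> u) *\<^sub>R u)"
      by (simp only: norm_triangle_ineq4)
    ultimately show ?thesis
      using normal unfolding distrib_right by linarith
  qed
  show thesis
    by (rule that[OF _ bound]) (use C \<tau>0 in auto)
qed

text \<open>The velocity of a line is constant, so orthogonality gives the foot point exactly, with
  no quadratic error.\<close>

lemma proj_set_line:
  fixes v :: "'a::real_inner"
  assumes "norm v = 1" "z \<in> proj_set (range (\<lambda>s. f + s *\<^sub>R v)) r"
  shows "z - f = ((r - f) \<bullet> v) *\<^sub>R v"
proof -
  obtain s where s: "z = f + s *\<^sub>R v" using proj_setD(1)[OF assms(2)] by auto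
  have "(r - (f + s *\<^sub>R v)) \<bullet> v = 0"
    by (rule proj_set_orthogonal_velocity[where g = "\<lambda>s. f + s *\<^sub>R v", OF assms(2)[unfolded s]])
      (auto intro!: derivative_eq_intros)
  moreover have "v \<bullet> v = 1" using assms(1) by (simp add: norm_eq_1)
  ultimately have "s = (r - f) \<bullet> v" by (simp add: inner_diff_left inner_add_left)
  then show ?thesis by (simp add: s)
qed

section \<open>Line reflections and their composition in the plane\<close>

lemma norm_line_reflection:
  fixes v d :: "'a::real_inner"
  assumes "norm v = 1"
  shows "norm ((2 * (d \<bullet> v)) *\<^sub>R v - d) = norm d"
proof -
  have "v \<bullet> v = 1" using assms by (simp add: norm_eq_1)
  then show ?thesis
    by (simp add: norm_eq inner_diff_left inner_diff_right inner_commute[of v d] algebra_simps)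
qed

text \<open>Three vectors in the plane are linearly dependent, so their Gram determinant vanishes;
  this is its expansion. Dimension two enters the norm computation here.\<close>

lemma gram_determinant_eq_0:
  fixes d u v :: "real^2"
  shows "(d \<bullet> d) * ((u \<bullet> u) * (v \<bullet> v) - (u \<bullet> v)\<^sup>2)
    = (d \<bullet> u)\<^sup>2 * (v \<bullet> v) + (d \<bullet> v)\<^sup>2 * (u \<bullet> u) - 2 * (d \<bullet> u) * (d \<bullet> v) * (u \<bullet> v)"
  by (simp add: inner_vec_def sum_2 power2_eq_square algebra_simps)

text \<open>If \<theta> is the angle between \<open>u\<close> and \<open>v\<close>, the two
  reflections compose to a rotation by 2\<theta>, and its mean with the identity scales norms by the
  absolute value of cos \<theta>. Algebraically, the Gram identity reduces the expanded squared norm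
  to \<open>c\<^sup>2 * (d \<bullet> d)\<close>.\<close>

lemma norm_half_id_plus_two_reflections:
  fixes d u v :: "real^2"
  assumes "norm u = 1" "norm v = 1"
  defines "r \<equiv> (2 * (d \<bullet> u)) *\<^sub>R u - d"
  shows "norm ((1/2) *\<^sub>R (d + ((2 * (r \<bullet> v)) *\<^sub>R v - r))) = \<bar>u \<bullet> v\<bar> * norm d" (is "norm ?w = _")
proof -
  have u: "u \<bullet> u = 1" and v: "v \<bullet> v = 1" using assms(1,2) by (simp_all add: norm_eq_1)
  define \<alpha> \<beta> c where "\<alpha> = d \<bullet> u" and "\<beta> = d \<bullet> v" and "c = u \<bullet> v"
  note abc = \<alpha>_def[symmetric] \<beta>_def[symmetric] c_def[symmetric]
  have rv: "r \<bullet> v = 2 * \<alpha> * c - \<beta>" by (simp add: r_def inner_diff_left abc)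
  have "2 *\<^sub>R ?w = 2 *\<^sub>R (d + (2 * \<alpha> * c - \<beta>) *\<^sub>R v - \<alpha> *\<^sub>R u)"
    unfolding rv r_def by (simp add: abc algebra_simps scaleR_2)
  then have w: "?w = d + (2 * \<alpha> * c - \<beta>) *\<^sub>R v - \<alpha> *\<^sub>R u"
    by (simp only: scaleR_cancel_left) simp
  have "(norm ?w)\<^sup>2 = d \<bullet> d - \<alpha>\<^sup>2 - \<beta>\<^sup>2 + 2 * \<alpha> * \<beta> * c"
    unfolding w power2_norm_eq_inner
    by (simp add: inner_add_left inner_add_right inner_diff_left inner_diff_right
        inner_commute[of u d] inner_commute[of v d] inner_commute[of v u] abc u v)
      (simp add: power2_eq_square algebra_simps)
  also have "\<dots> = c\<^sup>2 * (d \<bullet> d)"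
    using gram_determinant_eq_0[of d u v] by (simp add: abc u v algebra_simps)
  also have "\<dots> = (\<bar>c\<bar> * norm d)\<^sup>2"
    by (simp add: power_mult_distrib power2_norm_eq_inner)
  finally show ?thesis by (simp add: c_def power2_eq_iff_nonneg)
qed

section \<open>Parametrisations of lines and ellipses\<close>

text \<open>By dimension, \<open>f\<close> and a second point of \<open>L\<close> already span
  \<open>L\<close>. With \<open>f\<close> as base point, projection to \<open>L\<close> is linear in
  the displacement from \<open>f\<close>.\<close>

lemma line_eq_range:
  fixes L :: "'a::euclidean_space set"
  assumes "line L" "f \<in> L"
  obtains v where "norm v = 1" "L = range (\<lambda>s. f + s *\<^sub>R v)"
proof -
  have L: "affine L" "aff_dim L = 1" using assms(1) by (auto simp: line_def)
  then have "L \<noteq> {f}" by auto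
  then obtain g where g: "g \<in> L" "g \<noteq> f" using assms(2) by auto
  have "affine hull {f, g} = L"
    using L g assms(2) by (intro affine_dim_equal hull_minimal) (auto simp: aff_dim_2)
  then have L_eq: "L = range (\<lambda>s. f + s *\<^sub>R (g - f))" by (simp add: affine_hull_2_alt)
  define v where "v = sgn (g - f)"
  have scale: "g - f = norm (g - f) *\<^sub>R v" by (use g in \<open>simp add: v_def sgn_div_norm\<close>)
  have "range (\<lambda>s. f + s *\<^sub>R (g - f)) = range (\<lambda>s. f + s *\<^sub>R v)"
  proof (intro equalityI image_subsetI)
    fix s :: real
    show "f + s *\<^sub>R (g - f) \<in> range (\<lambda>s. f + s *\<^sub>R v)"
      by (rule range_eqI[of _ _ "s * norm (g - f)"]) (simp add: scale[symmetric] flip: scaleR_scaleR)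
    show "f + s *\<^sub>R v \<in> range (\<lambda>s. f + s *\<^sub>R (g - f))"
      by (rule range_eqI[of _ _ "s / norm (g - f)"]) (simp add: v_def sgn_div_norm divide_inverse)
  qed
  with L_eq that[of v] g show thesis by (simp add: v_def norm_sgn)
qed

text \<open>The semi-axes are the images of (1, 0) and (0, \<open>b\<close>) under the linear part
  of the similarity, which preserves orthogonality.\<close>

lemma ellipse_eq_range_trig_curve:
  assumes "ellipse E"
  obtains a p q where "p \<bullet> q = 0" "p \<noteq> 0" "q \<noteq> 0" "E = range (trig_curve a p q)"
proof -
  obtain b c Q a where b: "b > 0" and c: "c > 0" and Q: "orthogonal_transformation Q"
    and E: "E = (\<lambda>p. a + c *\<^sub>R Q p) ` standard_ellipse b"
    using assms unfolding ellipse_def by blast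
  have lin: "linear Q" using Q by (rule orthogonal_transformation_linear)
  define e1 e2 :: "real^2" where "e1 = axis 1 1" and "e2 = axis 2 1"
  define p q where "p = c *\<^sub>R Q e1" and "q = (c * b) *\<^sub>R Q e2"
  have std: "standard_ellipse b = range (\<lambda>t. cos t *\<^sub>R e1 + (b * sin t) *\<^sub>R e2)"
  proof (intro equalityI subsetI)
    fix y assume "y \<in> standard_ellipse b"
    then obtain t where "y $ 1 = cos t" "y $ 2 / b = sin t"
      using sincos_total_2pi[of "y$1" "y$2 / b"] by (auto simp: standard_ellipse_def)
    then have "y = cos t *\<^sub>R e1 + (b * sin t) *\<^sub>R e2"
      using b by (simp add: vec_eq_iff forall_2 e1_def e2_def axis_def field_simps)
    then show "y \<in> range (\<lambda>t. cos t *\<^sub>R e1 + (b * sin t) *\<^sub>R e2)" by blast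
  qed (use b in \<open>auto simp: standard_ellipse_def e1_def e2_def axis_def\<close>)
  show thesis
  proof (rule that)
    have "Q e1 \<bullet> Q e2 = 0" "norm (Q e1) = 1" "norm (Q e2) = 1"
      using Q by (simp_all add: orthogonal_transformation_def e1_def e2_def inner_axis_axis
          norm_eq_sqrt_inner)
    then show "p \<bullet> q = 0" "p \<noteq> 0" "q \<noteq> 0"
      using b c by (auto simp: p_def q_def)
    show "E = range (trig_curve a p q)"
      unfolding E std image_image
      by (simp add: trig_curve_def[abs_def] p_def q_def linear_add[OF lin] linear_scale[OF lin]
          algebra_simps)
  qed
qed

section \<open>Tangency and transversality\<close>

lemma inner_eq_one_imp_parallel:
  fixes u v :: "'a::real_inner"
  assumes "norm u = 1" "norm v = 1" "\<bar>u \<bullet> v\<bar> = 1"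
  shows "v = u \<or> v = - u"
  using assms norm_cauchy_schwarz_abs_eq[of u v] by auto

text \<open>Were the absolute value 1, equality in Cauchy-Schwarz would make \<open>v\<close> a
  multiple of the velocity at \<open>t\<close>, and the curve itself would witness tangency.\<close>

lemma not_tangent_imp_transversal:
  fixes p q v :: "'a::euclidean_space"
  assumes "p \<bullet> q = 0" "p \<noteq> 0" "q \<noteq> 0" "norm v = 1"
    and nt: "\<not> tangent_line (range (trig_curve a p q)) (range (\<lambda>s. trig_curve a p q t + s *\<^sub>R v))"
  shows "\<bar>sgn (trig_velocity p q t) \<bullet> v\<bar> < 1"
proof (rule ccontr)
  define \<tau> where "\<tau> = trig_velocity p q t"
  have \<tau>0: "\<tau> \<noteq> 0" using trig_velocity_nonzero[OF assms(1-3)] by (simp add: \<tau>_def)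
  have u1: "norm (sgn \<tau>) = 1" using \<tau>0 by (simp add: norm_sgn)
  assume "\<not> \<bar>sgn (trig_velocity p q t) \<bullet> v\<bar> < 1"
  then have "\<bar>sgn \<tau> \<bullet> v\<bar> = 1"
    using Cauchy_Schwarz_ineq2[of "sgn \<tau>" v] u1 assms(4) by (simp add: \<tau>_def)
  then have v: "v = sgn \<tau> \<or> v = - sgn \<tau>"
    by (rule inner_eq_one_imp_parallel[OF u1 assms(4)])
  \<comment> \<open>\<open>tangent_line\<close> takes the velocity at time 0, hence the shift by
    \<open>t\<close>; scaling time by \<open>k\<close> later makes that velocity exactly
    \<open>v\<close>.\<close>
  define g where "g h = trig_curve a p q (t + h)" for h
  have "((trig_curve a p q \<circ> (\<lambda>h. t + h)) has_vector_derivative (1 *\<^sub>R \<tau>)) (at 0)"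
    unfolding \<tau>_def
    by (rule vector_diff_chain_at)
      (auto intro!: derivative_eq_intros simp: trig_curve_has_vector_derivative)
  then have g': "(g has_vector_derivative \<tau>) (at 0)"
    by (simp add: g_def[abs_def] comp_def)
  have scaled: "(g \<circ> (\<lambda>h. k * h) has_vector_derivative k *\<^sub>R \<tau>) (at 0)" for k
    by (rule vector_diff_chain_at) (auto intro!: derivative_eq_intros simp: g')
  obtain k where k: "v = k *\<^sub>R \<tau>"
    using v by (metis sgn_div_norm scaleR_minus_left)
  have "tangent_line (range (trig_curve a p q)) (range (\<lambda>s. trig_curve a p q t + s *\<^sub>R v))"
    unfolding tangent_line_def
    using scaled[of k] assms(4)
    by (intro exI[of _ "g \<circ> (\<lambda>h. k * h)"] exI[of _ v]) (auto simp: g_def k)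
  with nt show False by blast
qed

section \<open>Local contraction and convergence\<close>

text \<open>The error \<open>e\<close> of the projection to the ellipse enters the result only
  through its reflection in the span of \<open>v\<close>, which preserves norms; hence the constant
  \<open>K\<close> of the projection estimate carries over.\<close>

lemma douglas_rachford_second_order:
  fixes a p q v :: "real^2" and t :: real
  assumes "p \<bullet> q = 0" "p \<noteq> 0" "q \<noteq> 0" "norm v = 1"
  defines "f \<equiv> trig_curve a p q t"
  obtains K where "K \<ge> 0"
    and "\<And>x y. y \<in> douglas_rachford (range (trig_curve a p q)) (range (\<lambda>s. f + s *\<^sub>R v)) x \<Longrightarrow>
      norm (y - f) \<le> \<bar>sgn (trig_velocity p q t) \<bullet> v\<bar> * norm (x - f) + K * (norm (x - f))\<^sup>2"
proof -
  define u where "u = sgn (trig_velocity p q t)"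
  have u1: "norm u = 1" using trig_velocity_nonzero[OF assms(1-3)] by (simp add: u_def norm_sgn)
  obtain K where K: "K \<ge> 0"
    and proj: "\<And>x z. z \<in> proj_set (range (trig_curve a p q)) x \<Longrightarrow>
           norm (z - f - ((x - f) \<bullet> u) *\<^sub>R u) \<le> K * (norm (x - f))\<^sup>2"
    using proj_set_trig_curve_second_order[OF assms(1-3), of a t] unfolding f_def u_def by blast
  have "norm (y - f) \<le> \<bar>u \<bullet> v\<bar> * norm (x - f) + K * (norm (x - f))\<^sup>2"
    if y: "y \<in> douglas_rachford (range (trig_curve a p q)) (range (\<lambda>s. f + s *\<^sub>R v)) x" for x y
  proof -
    obtain z z' where z: "z \<in> proj_set (range (trig_curve a p q)) x"
      and z': "z' \<in> proj_set (range (\<lambda>s. f + s *\<^sub>R v)) (2 *\<^sub>R z - x)"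
      and y_eq: "y = (1/2) *\<^sub>R (x + (2 *\<^sub>R z' - (2 *\<^sub>R z - x)))"
      using y unfolding douglas_rachford_def reflection_def by blast
    define d e where "d = x - f" and "e = z - f - ((x - f) \<bullet> u) *\<^sub>R u"
    \<comment> \<open>The reflection of \<open>d\<close> in the span of \<open>u\<close> models the
      reflection in the ellipse; the true one differs by \<open>2 *\<^sub>R e\<close>.\<close>
    define r where "r = (2 * (d \<bullet> u)) *\<^sub>R u - d"
    have r: "2 *\<^sub>R z - x - f = r + 2 *\<^sub>R e"
      by (simp add: r_def d_def e_def algebra_simps scaleR_2)
    have "z' = f + ((r + 2 *\<^sub>R e) \<bullet> v) *\<^sub>R v"
      using proj_set_line[OF assms(4) z'] unfolding r by (metis add.commute diff_add_cancel)
    then have "z' = f + (r \<bullet> v + 2 * (e \<bullet> v)) *\<^sub>R v"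
      by (simp only: inner_add_left inner_scaleR_left)
    moreover have "x = f + d" and rz: "2 *\<^sub>R z - x = f + r + 2 *\<^sub>R e"
      using r by (simp add: d_def, metis add.assoc add.commute diff_add_cancel)
    ultimately have "y - f = (1/2) *\<^sub>R ((f + d) + (2 *\<^sub>R (f + (r \<bullet> v + 2 * (e \<bullet> v)) *\<^sub>R v)
        - (f + r + 2 *\<^sub>R e))) - f"
      unfolding y_eq rz by blast
    also have "\<dots> = (1/2) *\<^sub>R (d + ((2 * (r \<bullet> v)) *\<^sub>R v - r)) + ((2 * (e \<bullet> v)) *\<^sub>R v - e)"
      by (simp add: vec_eq_iff field_simps)
    finally have "y - f = (1/2) *\<^sub>R (d + ((2 * (r \<bullet> v)) *\<^sub>R v - r)) + ((2 * (e \<bullet> v)) *\<^sub>R v - e)" .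
    then have "norm (y - f) \<le> norm ((1/2) *\<^sub>R (d + ((2 * (r \<bullet> v)) *\<^sub>R v - r)))
        + norm ((2 * (e \<bullet> v)) *\<^sub>R v - e)"
      by (simp only: norm_triangle_ineq)
    also have "\<dots> = \<bar>u \<bullet> v\<bar> * norm d + norm e"
      unfolding r_def
      by (simp only: norm_half_id_plus_two_reflections[OF u1 assms(4)]
          norm_line_reflection[OF assms(4)])
    also have "\<dots> \<le> \<bar>u \<bullet> v\<bar> * norm (x - f) + K * (norm (x - f))\<^sup>2"
      using proj[OF z] by (simp add: d_def e_def)
    finally show ?thesis .
  qed
  then show thesis using that[OF K] by (simp add: u_def)
qed

text \<open>Since \<open>k < 1\<close>, iterates never leave the ball of radius
  \<open>\<delta>\<close>, so \<open>step\<close> keeps applying and the distances decay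
  geometrically.\<close>

lemma local_contraction_tendsto:
  fixes x :: "nat \<Rightarrow> 'a::real_normed_vector"
  assumes "0 \<le> k" "k < 1" "norm (x 0 - f) < \<delta>"
    and step: "\<And>n. norm (x n - f) < \<delta> \<Longrightarrow> norm (x (Suc n) - f) \<le> k * norm (x n - f)"
  shows "(\<lambda>n. norm (x n - f)) \<longlonglongrightarrow> 0"
proof -
  have bound: "norm (x n - f) < \<delta> \<and> norm (x n - f) \<le> k ^ n * norm (x 0 - f)" for n
  proof (induction n)
    case (Suc n)
    then have le: "norm (x (Suc n) - f) \<le> k * norm (x n - f)" using step by blast
    also have "\<dots> \<le> k * (k ^ n * norm (x 0 - f))"
      using Suc.IH assms(1) by (intro mult_left_mono) blast+
    finally have "norm (x (Suc n) - f) \<le> k ^ Suc n * norm (x 0 - f)" by (simp add: mult.assoc)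
    moreover have "k * norm (x n - f) \<le> norm (x n - f)"
      using assms(1,2) by (intro mult_left_le_one_le) auto
    ultimately show ?case using le Suc by linarith
  qed (use assms(3) in simp)
  have "(\<lambda>n. k ^ n * norm (x 0 - f)) \<longlonglongrightarrow> 0"
    using assms(1,2) by (intro tendsto_mult_left_zero LIMSEQ_power_zero) auto
  from tendsto_const[of 0] this show ?thesis
    by (rule tendsto_sandwich[rotated 2]) (simp_all add: bound)
qed

theorem mainTheorem1:
  fixes E L :: "(real^2) set"
  assumes "ellipse E"
    and "line L"
    and "E \<inter> L \<noteq> {}"
    and "\<not> tangent_line E L"
  shows "\<forall>f \<in> E \<inter> L. \<exists>N. open N \<and> f \<in> N \<and>
    (\<forall>x0 \<in> N. \<forall>x :: nat \<Rightarrow> real^2.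
       x 0 = x0 \<and> (\<forall>n. x (Suc n) \<in> douglas_rachford E L (x n)) \<longrightarrow>
       (\<lambda>n. norm (x n - f)) \<longlonglongrightarrow> 0)"
proof
  fix f assume f: "f \<in> E \<inter> L"
  obtain a p q where pq: "p \<bullet> q = 0" "p \<noteq> 0" "q \<noteq> 0" and E: "E = range (trig_curve a p q)"
    using ellipse_eq_range_trig_curve[OF assms(1)] .
  obtain t where t: "f = trig_curve a p q t" using f E by auto
  obtain v where v: "norm v = 1" and L: "L = range (\<lambda>s. f + s *\<^sub>R v)"
    using line_eq_range[OF assms(2)] f by blast
  define c where "c = \<bar>sgn (trig_velocity p q t) \<bullet> v\<bar>"
  have c1: "c < 1"
    unfolding c_def using not_tangent_imp_transversal[OF pq v] assms(4) by (simp add: E L t)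
  have c0: "c \<ge> 0" by (simp add: c_def)
  obtain K where K: "K \<ge> 0"
    and dr: "\<And>x y. y \<in> douglas_rachford E L x \<Longrightarrow>
      norm (y - f) \<le> c * norm (x - f) + K * (norm (x - f))\<^sup>2"
    using douglas_rachford_second_order[OF pq v, of a t] unfolding E L t c_def by blast
  \<comment> \<open>Within this radius the quadratic term is at most \<open>(1 - c) / 2\<close>
    times the distance, which leaves the rate \<open>c + (1 - c) / 2 = (1 + c) / 2\<close>. The
    summand 1 keeps the denominator positive when \<open>K = 0\<close>.\<close>
  define \<delta> where "\<delta> = (1 - c) / (2 * (K + 1))"
  have \<delta>: "\<delta> > 0" using c1 K by (simp add: \<delta>_def)
  have K\<delta>: "K * \<delta> \<le> (1 - c) / 2"
    using c1 K by (simp add: \<delta>_def field_simps)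
  have contraction: "norm (y - f) \<le> (1 + c) / 2 * norm (x - f)"
    if "y \<in> douglas_rachford E L x" "norm (x - f) < \<delta>" for x y
  proof -
    have "K * norm (x - f) \<le> K * \<delta>" using K that(2) by (intro mult_left_mono) auto
    also note K\<delta>
    finally have "K * norm (x - f) * norm (x - f) \<le> (1 - c) / 2 * norm (x - f)"
      by (rule mult_right_mono) simp
    then show ?thesis using dr[OF that(1)] by (simp add: power2_eq_square field_simps)
  qed
  have "(\<lambda>n. norm (x n - f)) \<longlonglongrightarrow> 0"
    if "x 0 \<in> ball f \<delta>" "\<forall>n. x (Suc n) \<in> douglas_rachford E L (x n)" for x
  proof (rule local_contraction_tendsto)
    show "norm (x 0 - f) < \<delta>" using that(1) by (simp add: dist_norm norm_minus_commute)
    show "norm (x (Suc n) - f) \<le> (1 + c) / 2 * norm (x n - f)" if "norm (x n - f) < \<delta>" for n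
      using contraction that \<open>\<forall>n. x (Suc n) \<in> douglas_rachford E L (x n)\<close> by blast
  qed (use c0 c1 in auto)
  then show "\<exists>N. open N \<and> f \<in> N \<and>
    (\<forall>x0 \<in> N. \<forall>x :: nat \<Rightarrow> real^2.
       x 0 = x0 \<and> (\<forall>n. x (Suc n) \<in> douglas_rachford E L (x n)) \<longrightarrow>
       (\<lambda>n. norm (x n - f)) \<longlonglongrightarrow> 0)"
    using \<delta> by (intro exI[of _ "ball f \<delta>"]) auto
qed

end
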